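(* Let $N\geqslant 1$. The family $\big\{\det\Delta_0(\underline{\underline{\alpha}})\big\}_{\underline{\underline{\alpha}}\in\mathcal{B}^{N+}}$ is a basis of the complex vector space $$E=\mathbb{C}\big[x_{0i}^{(l)}\ :\ 1\leqslant i\leqslant N,\ l\geqslant 0\big].$$
   Context: The $x_{0i}^{(l)}$ ($1\leqslant i\leqslant N$, $l\geqslant0$) are independent variables, $x_{0i}=x_{0i}^{(0)}$, $x_{0i}'=x_{0i}^{(1)}$, etc. $\mathcal{B}^{N+}$ is the set of $N$-tuples $\underline{\underline{\alpha}}=(\underline{\alpha}^1,\dots,\underline{\alpha}^N)$ of finite (possibly empty) strictly increasing sequences $\underline{\alpha}^j=(\alpha^j_1<\dots<\alpha^j_{n_j})$ of integers $\geqslant 0$ such that, with $s_{N+1}=0$ and $s_j=n_N+n_{N-1}+\dots+n_j$, one has $\alpha^j_i\geqslant s_{j+1}$ for all $1\leqslant j\leqslant N$, $1\leqslant i\leqslant n_j$. For an integer $\alpha\geqslant0$ and a variable $\chi$ with derivatives $\chi^{(l)}$, the column $\mathcal{C}_\alpha(\chi)$ has $l$-th entry $\binom{\alpha}{l-1}\chi^{(\alpha-l+1)}$ ($l\geqslant 1$), interpreted as $0$ if $l-1>\alpha$. $\Delta_0(\underline{\underline{\alpha}})$ is the square matrix of size $s_1=n_1+\dots+n_N$ with columns, from left to right, $\mathcal{C}_{\alpha^N_1}(x_{0N}),\dots,\mathcal{C}_{\alpha^N_{n_N}}(x_{0N}),\mathcal{C}_{\alpha^{N-1}_1}(x_{0,N-1}),\dots,\mathcal{C}_{\alpha^1_{n_1}}(x_{01})$,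 all truncated to length $s_1$. The determinant of the empty matrix is $1$. *)

theory Defs
  imports Complex_Main "HOL-Library.Poly_Mapping" "HOL-Library.FuncSet"
    "Jordan_Normal_Form.Determinant"
begin

text \<open>Complex polynomials in variables indexed by pairs \<open>(i, l)\<close>; the pair \<open>(i, l)\<close> stands for
  \<open>x\<^sub>0\<^sub>i\<close> differentiated \<open>l\<close> times. Outer keys are monomials, i.e. exponent vectors of finite support.\<close>

type_synonym diff_poly = "(nat \<times> nat \<Rightarrow>\<^sub>0 nat) \<Rightarrow>\<^sub>0 complex"

definition dvar :: "nat \<Rightarrow> nat \<Rightarrow> diff_poly" where
  "dvar i l = Poly_Mapping.single (Poly_Mapping.single (i, l) 1) 1"

definition dscale :: "complex \<Rightarrow> diff_poly \<Rightarrow> diff_poly" where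
  "dscale c p = Poly_Mapping.single 0 c * p"

global_interpretation dpoly: vector_space dscale
  by unfold_locales
    (simp_all add: dscale_def algebra_simps single_add mult_single flip: mult.assoc)

text \<open>The type has variables for every \<open>i\<close>; the polynomial ring in question only uses
  \<open>1 \<le> i \<le> N\<close>.\<close>

definition diff_poly_space :: "nat \<Rightarrow> diff_poly set" where
  "diff_poly_space N =
     {p. \<forall>m \<in> Poly_Mapping.keys p. Poly_Mapping.keys m \<subseteq> {1..N} \<times> UNIV}"

definition tail_length :: "nat \<Rightarrow> (nat \<Rightarrow> nat list) \<Rightarrow> nat \<Rightarrow> nat" where
  "tail_length N \<alpha> j = (\<Sum>k = j..N. length (\<alpha> k))"

definition B_plus :: "nat \<Rightarrow> (nat \<Rightarrow> nat list) set" where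
  "B_plus N = {\<alpha> \<in> {1..N} \<rightarrow>\<^sub>E {as. sorted_wrt (<) as}.
     \<forall>j \<in> {1..N}. \<forall>a \<in> set (\<alpha> j). tail_length N \<alpha> (Suc j) \<le> a}"

text \<open>Rows are counted from \<open>0\<close>, so \<open>r\<close> is \<open>l - 1\<close> in the usual numbering; for \<open>r > a\<close> the
  binomial coefficient vanishes, so the truncated subtraction is harmless.\<close>

definition col_entry :: "nat \<Rightarrow> nat \<Rightarrow> nat \<Rightarrow> diff_poly" where
  "col_entry i a r = of_nat (a choose r) * dvar i (a - r)"

text \<open>The pairs \<open>(j, a)\<close> labelling the columns from left to right: the blocks run from \<open>j = N\<close>
  down to \<open>j = 1\<close>.\<close>

definition column_labels :: "nat \<Rightarrow> (nat \<Rightarrow> nat list) \<Rightarrow> (nat \<times> nat) list" where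
  "column_labels N \<alpha> = concat (map (\<lambda>j. map (Pair j) (\<alpha> j)) (rev [1..<Suc N]))"

definition Delta0 :: "nat \<Rightarrow> (nat \<Rightarrow> nat list) \<Rightarrow> diff_poly mat" where
  "Delta0 N \<alpha> = mat (tail_length N \<alpha> 1) (tail_length N \<alpha> 1)
     (\<lambda>(r, c). case column_labels N \<alpha> ! c of (j, a) \<Rightarrow> col_entry j a r)"

end

theory Submission imports Defs begin

text \<open>Order monomials by the additive weight giving the variable \<open>(j, l)\<close> the value
  \<open>j * l - (1/2)^l\<close>. For fixed \<open>j\<close> this is strictly concave in \<open>l\<close>, with slopes in \<open>(j, j + 1)\<close>, so an
  exchange argument shows that the diagonal product is the unique monomial of maximal weight in the
  expansion of the determinant. Subtracting the column positions from the labels turns each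
  \<open>\<alpha> j\<close> into a weakly increasing sequence, so the diagonal monomials run exactly once through all
  monomials: the family is triangular over the monomial basis. Since the determinants are
  homogeneous in degree and in total order of differentiation, only finitely many monomials are
  involved at a time, and induction on the weight gives the spanning property.\<close>

section \<open>Monomials as multisets of variables\<close>

definition factors :: "('a \<Rightarrow>\<^sub>0 nat) \<Rightarrow> 'a multiset" where
  "factors m = Abs_multiset (Poly_Mapping.lookup m)"

lemma count_factors [simp]: "count (factors m) x = Poly_Mapping.lookup m x"
  unfolding factors_def by (simp add: count_Abs_multiset)

lemma factors_eq_iff: "factors m = factors m' \<longleftrightarrow> m = m'"
  by (metis count_factors poly_mapping_eqI)

lemma factors_sum_single:
  "factors (\<Sum>c<(n::nat). Poly_Mapping.single (k c) 1) = image_mset k (mset_set {..<n})"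
  by (induction n)
    (auto simp: lookup_add lookup_single when_def multiset_eq_iff lessThan_Suc)

lemma set_mset_factors [simp]: "set_mset (factors m) = Poly_Mapping.keys m"
  by (auto simp: in_keys_iff set_mset_def)

section \<open>The exchange argument and the weight\<close>

text \<open>The bounds by \<open>A\<close> restrict the exchange to nonzero matrix entries, where the subtraction
  \<open>A c - r\<close> is not truncated. Swapping to make \<open>n\<close> a fixed point of \<open>\<sigma>\<close> preserves them.\<close>

lemma permutation_sum_less:
  fixes f :: "nat \<Rightarrow> nat \<Rightarrow> real" and A :: "nat \<Rightarrow> nat"
  assumes "\<sigma> permutes {..<n}" "\<sigma> \<noteq> id"
    and "\<And>c. c < n \<Longrightarrow> c \<le> A c" "\<And>c. c < n \<Longrightarrow> \<sigma> c \<le> A c"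
    and exchange: "\<And>c c' r r'. c < c' \<Longrightarrow> c' < n \<Longrightarrow> r < r' \<Longrightarrow> r' \<le> A c \<Longrightarrow> r' \<le> A c' \<Longrightarrow>
      f c r' + f c' r < f c r + f c' r'"
  shows "(\<Sum>c<n. f c (\<sigma> c)) < (\<Sum>c<n. f c c)"
  using assms
proof (induction n arbitrary: \<sigma>)
  case 0
  then show ?case by simp
next
  case (Suc n)
  have IH: "(\<Sum>c<n. f c (\<tau> c)) < (\<Sum>c<n. f c c)"
    if "\<tau> permutes {..<n}" "\<tau> \<noteq> id" "\<And>c. c < n \<Longrightarrow> \<tau> c \<le> A c" for \<tau>
  proof (rule Suc.IH[OF that(1,2) _ that(3)])
    show "c \<le> A c" if "c < n" for c using Suc.prems(3)[of c] that by simp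
    show "f c r' + f c' r < f c r + f c' r'"
      if "c < c'" "c' < n" "r < r'" "r' \<le> A c" "r' \<le> A c'" for c c' r r'
      using Suc.prems(5)[of c c' r r'] that by simp
  qed
  show ?case
  proof (cases "\<sigma> n = n")
    case True
    then have "\<sigma> permutes {..<n}"
      by (intro permutes_superset[OF Suc.prems(1)]) (auto simp: less_Suc_eq)
    moreover have "\<sigma> c \<le> A c" if "c < n" for c using Suc.prems(4)[of c] that by simp
    ultimately have "(\<Sum>c<n. f c (\<sigma> c)) < (\<Sum>c<n. f c c)"
      using Suc.prems(2) by (intro IH) auto
    then show ?thesis by (simp add: True)
  next
    case False
    define q where "q = \<sigma> n"
    obtain p where p: "\<sigma> p = n" using permutes_surj[OF Suc.prems(1)] by (metis surjD)
    have pn: "p < n"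
      using p False permutes_in_image[OF Suc.prems(1), of p] by (cases "p = n") (simp_all add: less_Suc_eq)
    have qn: "q < n"
      using False permutes_in_image[OF Suc.prems(1), of n] unfolding q_def by (simp add: less_Suc_eq)
    define \<tau> where "\<tau> = \<sigma> \<circ> transpose p n"
    have \<tau>p: "\<tau> p = q" and \<tau>n: "\<tau> n = n" by (auto simp: \<tau>_def q_def p)
    have \<tau>o: "\<tau> c = \<sigma> c" if "c \<noteq> p" "c \<noteq> n" for c
      using that by (simp add: \<tau>_def transpose_def)
    have "\<tau> permutes {..<Suc n}"
      unfolding \<tau>_def using Suc.prems(1) pn
      by (intro permutes_compose permutes_swap_id) auto
    then have \<tau>perm: "\<tau> permutes {..<n}"
      using \<tau>n by (elim permutes_superset) (auto simp: less_Suc_eq)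
    have nA: "n \<le> A p" using Suc.prems(4)[of p] pn p by auto
    have \<tau>A: "\<tau> c \<le> A c" if "c < n" for c
      using Suc.prems(4)[of c] \<tau>p \<tau>o[of c] nA qn that by (cases "c = p") auto
    have split: "(\<Sum>c<n. g c) = g p + (\<Sum>c\<in>{..<n}-{p}. g c)" for g :: "nat \<Rightarrow> real"
      using pn by (simp add: sum.remove)
    have "(\<Sum>c<Suc n. f c (\<sigma> c)) = (f p n + f n q) + (\<Sum>c\<in>{..<n}-{p}. f c (\<sigma> c))"
      by (simp add: split p q_def)
    \<comment> \<open>Exchange for the columns \<open>p < n\<close> and the rows
      \<open>q < n\<close>: \<open>n \<le> A p\<close> because \<sigma> sends \<open>p\<close> to
      \<open>n\<close>, and \<open>n \<le> A n\<close> by the bound on the diagonal.\<close>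
    also have "\<dots> < (f p q + f n n) + (\<Sum>c\<in>{..<n}-{p}. f c (\<sigma> c))"
      using Suc.prems(5)[of p n q n] pn qn nA Suc.prems(3)[of n] by (simp only: less_Suc_eq le_refl) simp
    also have "(\<Sum>c\<in>{..<n}-{p}. f c (\<sigma> c)) = (\<Sum>c\<in>{..<n}-{p}. f c (\<tau> c))"
      by (intro sum.cong) (auto simp: \<tau>o)
    also have "(f p q + f n n) + \<dots> = (\<Sum>c<n. f c (\<tau> c)) + f n n"
      by (simp add: split \<tau>p)
    \<comment> \<open>For \<open>\<tau> = id\<close> this is an equality; strictness already came
      from the exchange.\<close>
    also have "\<dots> \<le> (\<Sum>c<n. f c c) + f n n"
      using IH[OF \<tau>perm _ \<tau>A] by (cases "\<tau> = id") (simp_all add: less_imp_le)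
    finally show ?thesis by simp
  qed
qed

definition key_weight :: "nat \<times> nat \<Rightarrow> real" where
  "key_weight = (\<lambda>(j, l). real j * real l - (1 / 2) ^ l)"

text \<open>With \<open>d = r' - r\<close>, this compares two increments of the weight over
  \<open>d\<close> steps: in block \<open>j'\<close> from order \<open>a' - r'\<close> and in block
  \<open>j\<close> from \<open>a - r'\<close>. For \<open>j' < j\<close> the ranges of slopes are
  disjoint; for \<open>j' = j\<close> concavity favours the smaller starting order.\<close>

lemma key_weight_exchange:
  assumes "j' < j \<or> j' = j \<and> a < a'" "r < r'" "r' \<le> a" "r' \<le> a'"
  shows "key_weight (j, a - r') + key_weight (j', a' - r)
    < key_weight (j, a - r) + key_weight (j', a' - r')"
proof -
  define d where "d = r' - r"
  have d: "d > 0" "a - r = (a - r') + d" "a' - r = (a' - r') + d" using assms by (auto simp: d_def)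
  define x where "x = a - r'"
  define y where "y = a' - r'"
  define h :: "nat \<Rightarrow> real" where "h l = (1/2)^l" for l
  have h: "h (u + d) < h u" for u
    using d(1) unfolding h_def by (intro power_strict_decreasing) auto
  have "h y - h (y + d) + real j' * real d < h x - h (x + d) + real j * real d"
  proof (cases "j' < j")
    case True
    \<comment> \<open>The left perturbation is below 1, the right one is positive, and the gap
      \<open>(j - j') * d\<close> is at least \<open>d \<ge> 1\<close>.\<close>
    have "h y \<le> 1" "h (y + d) > 0" by (auto simp: h_def power_le_one)
    then have "h y - h (y + d) < 1" by simp
    also have "1 \<le> real d" using d by simp
    also have "real j' * real d + real d \<le> real j * real d"
      using mult_right_mono[of "real j' + 1" "real j" "real d"] True by (simp add: algebra_simps)
    finally show ?thesis using h[of x] True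
      by (smt (verit, del_insts) \<open>1 \<le> real d\<close> \<open>h y - h (y + d) < 1\<close> \<open>real j' * real d + real d \<le> real j * real d\<close>)
  next
    case False
    then have j: "j' = j" "x < y" using assms by (auto simp: x_def y_def)
    \<comment> \<open>Since \<open>h (u + d) = h u * h d\<close>, the drop over \<open>d\<close>
      steps is \<open>h u * (1 - h d)\<close>, which decreases in \<open>u\<close>.\<close>
    have "h y * (1 - h d) < h x * (1 - h d)"
    proof (rule mult_strict_right_mono)
      show "h y < h x" unfolding h_def using j by (intro power_strict_decreasing) auto
      show "0 < 1 - h d" using h[of 0] by (simp add: h_def)
    qed
    then show ?thesis using j by (simp add: h_def power_add algebra_simps)
  qed
  then show ?thesis unfolding key_weight_def d(2,3)
    by (simp add: x_def y_def h_def algebra_simps)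
qed

lemma lookup_dscale [simp]: "Poly_Mapping.lookup (dscale c p) m = c * Poly_Mapping.lookup p m"
  unfolding dscale_def mult_map_scale_conv_mult[symmetric] by (simp add: map.rep_eq when_def)

definition mono_weight :: "(nat \<times> nat \<Rightarrow>\<^sub>0 nat) \<Rightarrow> real" where
  "mono_weight m = (\<Sum>x\<in>#factors m. key_weight x)"

section \<open>Linear algebra of triangular families\<close>

text \<open>In a vanishing combination, consider the coefficient at a heaviest lead among the
  vectors with nonzero scalar: any other of them containing this monomial would have a strictly
  heavier lead. Distinct leads may well have equal weight.\<close>

lemma triangular_family:
  fixes v :: "'i \<Rightarrow> diff_poly" and w :: "_ \<Rightarrow> real"
  assumes lead_inj: "inj_on lead I"
    and lead: "\<And>i. i \<in> I \<Longrightarrow> Poly_Mapping.lookup (v i) (lead i) \<noteq> 0"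
    and smaller: "\<And>i m. i \<in> I \<Longrightarrow> m \<in> Poly_Mapping.keys (v i) \<Longrightarrow> m \<noteq> lead i \<Longrightarrow> w m < w (lead i)"
  shows "inj_on v I" "dpoly.independent (v ` I)"
proof -
  have aux: "i = k" if "i \<in> I" "k \<in> I" "w (lead k) \<le> w (lead i)" 
    "lead i \<in> Poly_Mapping.keys (v k)" for i k
    using smaller[of k "lead i"] that lead_inj by (auto dest: inj_onD)
  show inj: "inj_on v I"
  proof (rule inj_onI)
    fix i k assume "i \<in> I" "k \<in> I" "v i = v k"
    moreover from this have "lead i \<in> Poly_Mapping.keys (v k)" "lead k \<in> Poly_Mapping.keys (v i)"
      using lead[of i] lead[of k] by (auto simp: in_keys_iff)
    ultimately show "i = k" using aux[of i k] aux[of k i] by (metis linear)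
  qed
  show "dpoly.independent (v ` I)"
  proof
    assume "dpoly.dependent (v ` I)"
    then obtain t u where t: "finite t" "t \<subseteq> v ` I" "(\<Sum>p\<in>t. dscale (u p) p) = 0" "\<exists>p\<in>t. u p \<noteq> 0"
      unfolding dpoly.dependent_explicit by blast
    \<comment> \<open>Zero scalars are discarded before taking the maximum; injectivity of
      \<open>v\<close> makes the index set finite.\<close>
    define J where "J = {i \<in> I. v i \<in> t \<and> u (v i) \<noteq> 0}"
    have "finite (v ` J)" using t(1) by (rule finite_subset[rotated]) (auto simp: J_def)
    moreover have "inj_on v J" using inj by (rule inj_on_subset) (auto simp: J_def)
    ultimately have fin: "finite J" by (rule finite_imageD)
    have "J \<noteq> {}" using t by (auto simp: J_def)
    then have "Max ((\<lambda>k. w (lead k)) ` J) \<in> (\<lambda>k. w (lead k)) ` J"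
      using fin by (intro Max_in) auto
    then obtain i where i: "i \<in> J" "w (lead i) = Max ((\<lambda>k. w (lead k)) ` J)" by auto
    have max: "w (lead k) \<le> w (lead i)" if "k \<in> J" for k
      using that fin i(2) by simp
    have "0 = Poly_Mapping.lookup (\<Sum>p\<in>t. dscale (u p) p) (lead i)" using t(3) by simp
    also have "\<dots> = (\<Sum>p\<in>t. u p * Poly_Mapping.lookup p (lead i))"
      by (simp add: lookup_sum)
    also have "\<dots> = (\<Sum>p\<in>{v i}. u p * Poly_Mapping.lookup p (lead i))"
    proof (rule sum.mono_neutral_right)
      show "\<forall>p\<in>t - {v i}. u p * Poly_Mapping.lookup p (lead i) = 0"
      proof (rule ballI, rule ccontr)
        fix p assume p: "p \<in> t - {v i}" "u p * Poly_Mapping.lookup p (lead i) \<noteq> 0"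
        then obtain k where "k \<in> J" "p = v k" using t(2) by (auto simp: J_def)
        then show False using aux[of i k] p i max[of k] by (auto simp: J_def in_keys_iff)
      qed
    qed (use t(1) i in \<open>auto simp: J_def\<close>)
    also have "\<dots> \<noteq> 0" using i lead by (auto simp: J_def)
    finally show False by simp
  qed
qed

section \<open>Expansion of the determinant into monomials\<close>

text \<open>The monomial of the Leibniz term of \<sigma>, which uses column \<open>c\<close> in row
  \<open>\<sigma> c\<close>. Where the subtraction truncates, a binomial coefficient of that term is
  zero.\<close>

definition exponent :: "(nat \<times> nat) list \<Rightarrow> (nat \<Rightarrow> nat) \<Rightarrow> (nat \<times> nat \<Rightarrow>\<^sub>0 nat)" where
  "exponent L \<sigma> = (\<Sum>c<length L. Poly_Mapping.single (fst (L ! c), snd (L ! c) - \<sigma> c) 1)"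

lemma factors_exponent:
  "factors (exponent L \<sigma>) =
    image_mset (\<lambda>c. (fst (L ! c), snd (L ! c) - \<sigma> c)) (mset_set {..<length L})"
  unfolding exponent_def by (rule factors_sum_single)

definition label_less :: "nat \<times> nat \<Rightarrow> nat \<times> nat \<Rightarrow> bool" where
  "label_less = (\<lambda>(j, a) (j', a'). j' < j \<or> j' = j \<and> a < a')"

lemma mono_weight_exponent_less:
  assumes "sorted_wrt label_less L" "\<And>c. c < length L \<Longrightarrow> c \<le> snd (L ! c)"
    and "\<sigma> permutes {..<length L}" "\<sigma> \<noteq> id" "\<And>c. c < length L \<Longrightarrow> \<sigma> c \<le> snd (L ! c)"
  shows "mono_weight (exponent L \<sigma>) < mono_weight (exponent L id)"
proof -
  have eq: "mono_weight (exponent L \<tau>) =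
      (\<Sum>c<length L. key_weight (fst (L ! c), snd (L ! c) - \<tau> c))" for \<tau>
    by (simp add: mono_weight_def factors_exponent image_mset.compositionality comp_def sum_unfold_sum_mset)
  have "(\<Sum>c<length L. key_weight (fst (L ! c), snd (L ! c) - \<sigma> c))
      < (\<Sum>c<length L. key_weight (fst (L ! c), snd (L ! c) - c))"
  proof (rule permutation_sum_less[where A = "\<lambda>c. snd (L ! c)"
        and f = "\<lambda>c r. key_weight (fst (L ! c), snd (L ! c) - r)"])
    fix c c' r r'
    assume "c < c'" "c' < length L" "r < r'" "r' \<le> snd (L ! c)" "r' \<le> snd (L ! c')"
    moreover from this have "label_less (L ! c) (L ! c')"
      using assms(1) by (simp add: sorted_wrt_iff_nth_less)
    ultimately show "key_weight (fst (L ! c), snd (L ! c) - r') + key_weight (fst (L ! c'), snd (L ! c') - r)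
      < key_weight (fst (L ! c), snd (L ! c) - r) + key_weight (fst (L ! c'), snd (L ! c') - r')"
      by (intro key_weight_exchange) (auto simp: label_less_def split: prod.splits)
  qed (use assms in auto)
  then show ?thesis by (simp add: eq)
qed

lemma prod_single:
  fixes k :: "'b \<Rightarrow> 'c::comm_monoid_add" and c :: "'b \<Rightarrow> 'd::comm_semiring_1"
  assumes "finite A"
  shows "(\<Prod>x\<in>A. Poly_Mapping.single (k x) (c x)) = Poly_Mapping.single (\<Sum>x\<in>A. k x) (\<Prod>x\<in>A. c x)"
  using assms by induction (simp_all add: mult_single)

text \<open>Each entry is a scalar times one variable, so a Leibniz term is a single monomial. Terms
  are not collected: several permutations can give the same monomial.\<close>

lemma det_Delta0:
  fixes N \<alpha>
  defines "L \<equiv> column_labels N \<alpha>"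
  assumes len: "length L = tail_length N \<alpha> 1"
  shows "det (Delta0 N \<alpha>) = (\<Sum>\<sigma> | \<sigma> permutes {..<length L}. 
    Poly_Mapping.single (exponent L \<sigma>) (of_int (sign \<sigma>) * (\<Prod>c<length L. of_nat (snd (L ! c) choose \<sigma> c))))"
proof -
  have "Delta0 N \<alpha> \<in> carrier_mat (length L) (length L)"
    by (simp add: Delta0_def len)
  then have "det (Delta0 N \<alpha>) = (\<Sum>\<sigma> | \<sigma> permutes {..<length L}. 
    of_int (sign \<sigma>) * (\<Prod>c<length L. Delta0 N \<alpha> $$ (\<sigma> c, c)))"
    by (subst det_col) (simp_all add: atLeast0LessThan)
  also have "\<dots> = (\<Sum>\<sigma> | \<sigma> permutes {..<length L}. 
    Poly_Mapping.single (exponent L \<sigma>) (of_int (sign \<sigma>) * (\<Prod>c<length L. of_nat (snd (L ! c) choose \<sigma> c))))"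
  proof (intro sum.cong refl)
    fix \<sigma> assume "\<sigma> \<in> {\<sigma>. \<sigma> permutes {..<length L}}"
    then have \<sigma>: "\<sigma> c < length L" if "c < length L" for c
      using permutes_in_image[of \<sigma> "{..<length L}" c] that by simp
    have "(\<Prod>c<length L. Delta0 N \<alpha> $$ (\<sigma> c, c)) = (\<Prod>c<length L. 
        Poly_Mapping.single (Poly_Mapping.single (fst (L ! c), snd (L ! c) - \<sigma> c) 1) (of_nat (snd (L ! c) choose \<sigma> c)))"
    proof (intro prod.cong refl)
      fix c assume c: "c \<in> {..<length L}"
      then have "Delta0 N \<alpha> $$ (\<sigma> c, c) = col_entry (fst (L ! c)) (snd (L ! c)) (\<sigma> c)"
        using \<sigma>[of c] unfolding Delta0_def len[symmetric] by (simp add: L_def case_prod_beta)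
      also have "\<dots> = Poly_Mapping.single (Poly_Mapping.single (fst (L ! c), snd (L ! c) - \<sigma> c) 1) (of_nat (snd (L ! c) choose \<sigma> c))"
        unfolding col_entry_def dvar_def single_of_nat[symmetric] mult_single by simp
      finally show "Delta0 N \<alpha> $$ (\<sigma> c, c) = \<dots>" .
    qed
    also have "\<dots> = Poly_Mapping.single (exponent L \<sigma>) (\<Prod>c<length L. of_nat (snd (L ! c) choose \<sigma> c))"
      by (simp add: prod_single exponent_def)
    finally show "of_int (sign \<sigma>) * (\<Prod>c<length L. Delta0 N \<alpha> $$ (\<sigma> c, c)) =
      Poly_Mapping.single (exponent L \<sigma>) (of_int (sign \<sigma>) * (\<Prod>c<length L. of_nat (snd (L ! c) choose \<sigma> c)))"
      unfolding single_of_int[symmetric] by (simp only: mult_single add_0_left)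
  qed
  finally show ?thesis .
qed

section \<open>Index tuples and weakly increasing lists\<close>

text \<open>\<open>tail_length N \<alpha> (Suc j) + k\<close> is the position, counted from 0, of
  column \<open>k\<close> of block \<open>j\<close>, so the entries are the orders of
  differentiation on the diagonal.\<close>

definition parts :: "nat \<Rightarrow> (nat \<Rightarrow> nat list) \<Rightarrow> nat \<Rightarrow> nat list" where
  "parts N \<alpha> j = map (\<lambda>k. \<alpha> j ! k - (tail_length N \<alpha> (Suc j) + k)) [0..<length (\<alpha> j)]"

lemma sorted_wrt_less_nth_ge:
  fixes xs :: "nat list"
  assumes "sorted_wrt (<) xs" "\<forall>a\<in>set xs. t \<le> a" "k < length xs"
  shows "t + k \<le> xs ! k"
  using assms(3)
proof (induction k)
  case 0
  then show ?case using assms(2) by simp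
next
  case (Suc k)
  then have "xs ! k < xs ! Suc k" using assms(1) by (simp add: sorted_wrt_iff_nth_less)
  with Suc show ?case by simp
qed

text \<open>Strict increase gains at least one per step, so the lower bound of a block grows into
  the column position itself. Hence the subtraction in \<open>parts\<close> is exact and no diagonal
  binomial vanishes.\<close>

lemma B_plusD:
  assumes "\<alpha> \<in> B_plus N" "j \<in> {1..N}"
  shows "sorted_wrt (<) (\<alpha> j)"
    and "k < length (\<alpha> j) \<Longrightarrow> tail_length N \<alpha> (Suc j) + k \<le> \<alpha> j ! k"
proof -
  show s: "sorted_wrt (<) (\<alpha> j)" using assms by (auto simp: B_plus_def PiE_def Pi_def)
  show "k < length (\<alpha> j) \<Longrightarrow> tail_length N \<alpha> (Suc j) + k \<le> \<alpha> j ! k"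
    using assms by (intro sorted_wrt_less_nth_ge[OF s]) (auto simp: B_plus_def)
qed

lemma sorted_parts:
  assumes "\<alpha> \<in> B_plus N" "j \<in> {1..N}"
  shows "sorted (parts N \<alpha> j)"
  unfolding sorted_iff_nth_Suc
proof (intro allI impI)
  fix k assume k: "Suc k < length (parts N \<alpha> j)"
  then have "\<alpha> j ! k < \<alpha> j ! Suc k"
    using B_plusD(1)[OF assms] by (simp add: sorted_wrt_iff_nth_less parts_def)
  then show "parts N \<alpha> j ! k \<le> parts N \<alpha> j ! Suc k" using k by (simp add: parts_def)
qed

lemma tail_length_rec: "i \<le> N \<Longrightarrow> tail_length N \<alpha> i = length (\<alpha> i) + tail_length N \<alpha> (Suc i)"
  by (simp add: tail_length_def sum.atLeast_Suc_atMost)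

text \<open>A sorted list is determined by its multiset. The lists give the block lengths, hence the
  column positions, and adding these back recovers the labels.\<close>

lemma parts_inj:
  assumes "\<alpha> \<in> B_plus N" "\<beta> \<in> B_plus N"
    and "\<And>j. j \<in> {1..N} \<Longrightarrow> mset (parts N \<alpha> j) = mset (parts N \<beta> j)"
  shows "\<alpha> = \<beta>"
proof -
  have parts: "parts N \<alpha> j = parts N \<beta> j" if "j \<in> {1..N}" for j
    using sorted_parts[OF assms(1) that] sorted_parts[OF assms(2) that] assms(3)[OF that]
    by (metis sorted_sort_id properties_for_sort)
  have len: "length (\<alpha> j) = length (\<beta> j)" if "j \<in> {1..N}" for j
    using arg_cong[OF parts[OF that], of length] by (simp add: parts_def)
  have tail: "tail_length N \<alpha> (Suc j) = tail_length N \<beta> (Suc j)" for j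
    unfolding tail_length_def by (intro sum.cong) (auto intro: len)
  have "\<alpha> j = \<beta> j" if j: "j \<in> {1..N}" for j
  proof (rule nth_equalityI)
    fix k assume k: "k < length (\<alpha> j)"
    have "parts N \<alpha> j ! k = parts N \<beta> j ! k" by (simp only: parts[OF j])
    then show "\<alpha> j ! k = \<beta> j ! k"
      using k len[OF j] B_plusD(2)[OF assms(1) j k] B_plusD(2)[OF assms(2) j, of k] tail[of j]
      by (simp add: parts_def)
  qed (rule len[OF j])
  \<comment> \<open>Outside \<open>{1..N}\<close> both functions are \<open>undefined\<close>, being
    extensional.\<close>
  then show ?thesis
    using assms(1,2) by (intro PiE_ext[of \<alpha> "{1..N}" "\<lambda>_. {as. sorted_wrt (<) as}" \<beta>]) (auto simp: B_plus_def)
qed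

text \<open>Column positions depend on the block lengths alone, which \<open>P\<close> already
  prescribes, so \<open>parts\<close> is inverted by adding the positions.\<close>

lemma parts_surj:
  assumes "\<And>j. j \<in> {1..N} \<Longrightarrow> sorted (P j)"
  obtains \<alpha> where "\<alpha> \<in> B_plus N" "\<And>j. j \<in> {1..N} \<Longrightarrow> parts N \<alpha> j = P j"
proof
  define t where "t j = (\<Sum>k = j..N. length (P k))" for j
  define \<alpha> where "\<alpha> = (\<lambda>j\<in>{1..N}. map (\<lambda>k. P j ! k + (t (Suc j) + k)) [0..<length (P j)])"
  have tail: "tail_length N \<alpha> (Suc j) = t (Suc j)" for j
    unfolding tail_length_def t_def by (intro sum.cong) (auto simp: \<alpha>_def)
  have "sorted_wrt (<) (\<alpha> j)" if "j \<in> {1..N}" for j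
    using assms[OF that] that
    by (auto simp: \<alpha>_def sorted_wrt_iff_nth_less sorted_iff_nth_mono intro!: add_le_less_mono)
  then show "\<alpha> \<in> B_plus N"
    by (auto simp: B_plus_def tail) (auto simp: \<alpha>_def)
  show "parts N \<alpha> j = P j" if "j \<in> {1..N}" for j
    using that by (intro nth_equalityI) (auto simp: parts_def tail, auto simp: \<alpha>_def)
qed

section \<open>Order and positions of the columns\<close>

text \<open>An initial stretch of the column list: passing from \<open>Suc i\<close> to
  \<open>i\<close> appends block \<open>i\<close> on the right and leaves the earlier positions
  unchanged.\<close>

abbreviation labels_from :: "nat \<Rightarrow> (nat \<Rightarrow> nat list) \<Rightarrow> nat \<Rightarrow> (nat \<times> nat) list" where
  "labels_from N \<alpha> i \<equiv> concat (map (\<lambda>j. map (Pair j) (\<alpha> j)) (rev [i..<Suc N]))"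

lemma labels_from_rec:
  "i \<le> N \<Longrightarrow> labels_from N \<alpha> i = labels_from N \<alpha> (Suc i) @ map (Pair i) (\<alpha> i)"
  by (subst upt_conv_Cons) auto

lemma length_labels_from: 
  assumes "i \<le> Suc N"
  shows "length (labels_from N \<alpha> i) = tail_length N \<alpha> i"
  using assms
proof (induction i rule: inc_induct)
  case base
  then show ?case by (simp add: tail_length_def)
next
  case (step i)
  then show ?case by (simp add: labels_from_rec tail_length_rec del: upt_Suc)
qed

text \<open>Downward induction over the blocks: block \<open>i\<close> starts at position
  \<open>tail_length N \<alpha> (Suc i)\<close>, the offset used in \<open>parts\<close> and in
  \<open>B_plus\<close>. The first two facts feed the exchange argument, the third identifies the
  diagonal monomial.\<close>

lemma labels_from_props:
  assumes "\<alpha> \<in> B_plus N" "1 \<le> i" "i \<le> Suc N"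
  shows "sorted_wrt label_less (labels_from N \<alpha> i)" (is "?sorted i")
    and "\<forall>c < length (labels_from N \<alpha> i). c \<le> snd (labels_from N \<alpha> i ! c)" (is "?ge i")
    and "mset (map (\<lambda>c. (fst (labels_from N \<alpha> i ! c), snd (labels_from N \<alpha> i ! c) - c)) [0..<length (labels_from N \<alpha> i)])
      = (\<Sum>j = i..N. image_mset (Pair j) (mset (parts N \<alpha> j)))" (is "?parts i")
proof -
  have "?sorted i \<and> ?ge i \<and> ?parts i"
    using assms(3,2)
  proof (induction i rule: inc_induct)
    case base
    then show ?case by simp
  next
    case (step i)
    define L where "L = labels_from N \<alpha> (Suc i)"
    have i: "i \<in> {1..N}" "i \<le> N" using step by auto
    have rec: "labels_from N \<alpha> i = L @ map (Pair i) (\<alpha> i)"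
      unfolding L_def using i by (intro labels_from_rec) auto
    have len: "length L = tail_length N \<alpha> (Suc i)"
      unfolding L_def using i by (intro length_labels_from) auto
    have IH: "sorted_wrt label_less L" "\<forall>c < length L. c \<le> snd (L ! c)"
      "mset (map (\<lambda>c. (fst (L ! c), snd (L ! c) - c)) [0..<length L])
      = (\<Sum>j = Suc i..N. image_mset (Pair j) (mset (parts N \<alpha> j)))"
      using step.IH by (auto simp: L_def)
    have "i < fst x" if "x \<in> set L" for x using that by (auto simp: L_def)
    then have "label_less x y" if "x \<in> set L" "y \<in> set (map (Pair i) (\<alpha> i))" for x y
      using that by (fastforce simp: label_less_def)
    moreover have "sorted_wrt label_less (map (Pair i) (\<alpha> i))"
      using B_plusD(1)[OF assms(1) i(1)] by (simp add: sorted_wrt_map label_less_def)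
    ultimately have 1: "?sorted i" unfolding rec using IH(1) by (simp add: sorted_wrt_append)
    have 2: "?ge i" unfolding rec
    proof (intro allI impI)
      fix c assume c: "c < length (L @ map (Pair i) (\<alpha> i))"
      show "c \<le> snd ((L @ map (Pair i) (\<alpha> i)) ! c)"
        using c IH(2) B_plusD(2)[OF assms(1) i(1), of "c - length L"]
        by (cases "c < length L") (auto simp: nth_append len)
    qed
    have "map (\<lambda>c. (fst ((L @ map (Pair i) (\<alpha> i)) ! c), snd ((L @ map (Pair i) (\<alpha> i)) ! c) - c))
        [0..<length (L @ map (Pair i) (\<alpha> i))]
      = map (\<lambda>c. (fst (L ! c), snd (L ! c) - c)) [0..<length L] @ map (Pair i) (parts N \<alpha> i)"
      by (rule nth_equalityI) (auto simp: nth_append parts_def len)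
    then have 3: "?parts i" unfolding rec
      using IH(3) i by (simp add: sum.atLeast_Suc_atMost add.commute)
    show ?case using 1 2 3 by blast
  qed
  then show "?sorted i" "?ge i" "?parts i" by blast+
qed

lemma column_labels_eq: "column_labels N \<alpha> = labels_from N \<alpha> 1"
  by (simp add: column_labels_def)

lemma length_column_labels: "length (column_labels N \<alpha>) = tail_length N \<alpha> 1"
  unfolding column_labels_eq by (rule length_labels_from) simp

section \<open>Leading monomials of the determinants\<close>

abbreviation lead :: "nat \<Rightarrow> (nat \<Rightarrow> nat list) \<Rightarrow> (nat \<times> nat \<Rightarrow>\<^sub>0 nat)" where
  "lead N \<alpha> \<equiv> exponent (column_labels N \<alpha>) id"

text \<open>Reduces bijectivity of \<open>lead N\<close> to \<open>parts_inj\<close> and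
  \<open>parts_surj\<close>: the summands live on disjoint sets of pairs, so each multiset can be
  read off.\<close>

lemma factors_lead:
  assumes "\<alpha> \<in> B_plus N"
  shows "factors (lead N \<alpha>) = (\<Sum>j = 1..N. image_mset (Pair j) (mset (parts N \<alpha> j)))"
  using labels_from_props(3)[OF assms, of 1]
  by (simp add: factors_exponent column_labels_eq atLeast0LessThan del: upt_Suc)

lemma count_sum_image_Pair:
  "count (\<Sum>j = 1..(N::nat). image_mset (Pair j) (M j)) (i, l) = (if i \<in> {1..N} then count (M i) l else 0)"
proof -
  have "count (image_mset (Pair j) K) (i, l) = (if j = i then count K l else 0)" for j K
    by (induction K) auto
  then show ?thesis by (simp add: count_sum sum.delta)
qed

lemma inj_on_lead: "inj_on (lead N) (B_plus N)"
proof (rule inj_onI)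
  fix \<alpha> \<beta> assume *: "\<alpha> \<in> B_plus N" "\<beta> \<in> B_plus N" "lead N \<alpha> = lead N \<beta>"
  have "mset (parts N \<alpha> j) = mset (parts N \<beta> j)" if "j \<in> {1..N}" for j
  proof (rule multiset_eqI)
    fix l
    have "count (factors (lead N \<alpha>)) (j, l) = count (factors (lead N \<beta>)) (j, l)" using *(3) by simp
    then show "count (mset (parts N \<alpha> j)) l = count (mset (parts N \<beta> j)) l"
      unfolding factors_lead[OF *(1)] factors_lead[OF *(2)] count_sum_image_Pair using that by simp
  qed
  then show "\<alpha> = \<beta>" by (rule parts_inj[OF *(1,2)])
qed

text \<open>The orders occurring in \<open>m\<close> with index \<open>j\<close>, sorted with
  multiplicity, form the list that \<open>parts_surj\<close> turns into block
  \<open>j\<close>.\<close>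

lemma lead_surj:
  assumes "Poly_Mapping.keys m \<subseteq> {1..N} \<times> UNIV"
  obtains \<alpha> where "\<alpha> \<in> B_plus N" "lead N \<alpha> = m"
proof -
  define P where "P j = sorted_list_of_multiset (image_mset snd (filter_mset (\<lambda>x. fst x = j) (factors m)))" for j
  obtain \<alpha> where \<alpha>: "\<alpha> \<in> B_plus N" "\<And>j. j \<in> {1..N} \<Longrightarrow> parts N \<alpha> j = P j"
    using parts_surj[of N P] by (auto simp: P_def)
  have P: "count (mset (P j)) l = count (factors m) (j, l)" for j l
  proof -
    have "count (image_mset snd (filter_mset (\<lambda>x. fst x = j) K)) l = count K (j, l)"
      for K :: "(nat \<times> nat) multiset"
      by (induction K) auto
    then show ?thesis by (simp add: P_def)
  qed
  have "count (factors (lead N \<alpha>)) x = count (factors m) x" for x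
  proof (cases x)
    case (Pair i l)
    show ?thesis
      unfolding factors_lead[OF \<alpha>(1)] Pair count_sum_image_Pair
      using \<alpha>(2)[of i] P[of i l] assms by (auto simp: in_keys_iff)
  qed
  then have "lead N \<alpha> = m" by (simp add: multiset_eq_iff flip: factors_eq_iff)
  with \<alpha>(1) show ?thesis by (rule that)
qed

text \<open>Some Leibniz term with nonzero coefficient must produce \<open>m\<close>, and its
  binomials are nonzero exactly when \<sigma> does not exceed the labels.\<close>

lemma keys_det:
  assumes "m \<in> Poly_Mapping.keys (det (Delta0 N \<alpha>))"
  defines "L \<equiv> column_labels N \<alpha>"
  shows "\<exists>\<sigma>. \<sigma> permutes {..<length L} \<and> (\<forall>c < length L. \<sigma> c \<le> snd (L ! c)) \<and> m = exponent L \<sigma>"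
proof -
  have "(\<Sum>\<sigma> | \<sigma> permutes {..<length L}. Poly_Mapping.lookup (Poly_Mapping.single (exponent L \<sigma>)
    (of_int (sign \<sigma>) * (\<Prod>c<length L. of_nat (snd (L ! c) choose \<sigma> c))) :: diff_poly) m) \<noteq> 0"
    using assms(1) unfolding det_Delta0[OF length_column_labels] in_keys_iff lookup_sum L_def .
  then obtain \<sigma> where "\<sigma> permutes {..<length L}" and
    "Poly_Mapping.lookup (Poly_Mapping.single (exponent L \<sigma>)
    (of_int (sign \<sigma>) * (\<Prod>c<length L. of_nat (snd (L ! c) choose \<sigma> c))) :: diff_poly) m \<noteq> 0"
    by (blast elim: sum.not_neutral_contains_not_neutral)
  then show ?thesis
    by (intro exI[of _ \<sigma>]) (auto simp: lookup_single when_def not_less split: if_splits)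
qed

lemma mono_weight_keys_det:
  assumes "\<alpha> \<in> B_plus N" "m \<in> Poly_Mapping.keys (det (Delta0 N \<alpha>))" "m \<noteq> lead N \<alpha>"
  shows "mono_weight m < mono_weight (lead N \<alpha>)"
proof -
  from assms(2) obtain \<sigma> where "\<sigma> permutes {..<length (column_labels N \<alpha>)}"
    "\<And>c. c < length (column_labels N \<alpha>) \<Longrightarrow> \<sigma> c \<le> snd (column_labels N \<alpha> ! c)"
    "m = exponent (column_labels N \<alpha>) \<sigma>" using keys_det by blast
  then show ?thesis
    using assms(3) labels_from_props(1,2)[OF assms(1), of 1]
    by (auto intro!: mono_weight_exponent_less simp: column_labels_eq simp del: upt_Suc)
qed

text \<open>Strict maximality of the diagonal weight excludes every other permutation, so nothing
  cancels. The remaining product of \<open>snd (L ! c) choose c\<close> is nonzero because each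
  label is at least its position.\<close>

lemma lookup_det_lead:
  assumes "\<alpha> \<in> B_plus N"
  shows "Poly_Mapping.lookup (det (Delta0 N \<alpha>)) (lead N \<alpha>) \<noteq> 0"
proof -
  define L where "L = column_labels N \<alpha>"
  have L: "sorted_wrt label_less L" "\<And>c. c < length L \<Longrightarrow> c \<le> snd (L ! c)"
    using labels_from_props(1,2)[OF assms, of 1] by (auto simp: L_def column_labels_eq simp del: upt_Suc)
  define t :: "(nat \<Rightarrow> nat) \<Rightarrow> diff_poly" where "t \<sigma> = Poly_Mapping.single (exponent L \<sigma>)
    (of_int (sign \<sigma>) * (\<Prod>c<length L. of_nat (snd (L ! c) choose \<sigma> c)))" for \<sigma>
  have "Poly_Mapping.lookup (det (Delta0 N \<alpha>)) (lead N \<alpha>)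
      = (\<Sum>\<sigma> | \<sigma> permutes {..<length L}. Poly_Mapping.lookup (t \<sigma>) (exponent L id))"
    unfolding det_Delta0[OF length_column_labels] lookup_sum t_def L_def ..
  also have "\<dots> = (\<Sum>\<sigma>\<in>{id}. Poly_Mapping.lookup (t \<sigma>) (exponent L id))"
  proof (rule sum.mono_neutral_right)
    show "\<forall>\<sigma>\<in>{\<sigma>. \<sigma> permutes {..<length L}} - {id}. Poly_Mapping.lookup (t \<sigma>) (exponent L id) = 0"
    proof (intro ballI, rule ccontr)
      fix \<sigma> assume "\<sigma> \<in> {\<sigma>. \<sigma> permutes {..<length L}} - {id}"
        and nz: "Poly_Mapping.lookup (t \<sigma>) (exponent L id) \<noteq> 0"
      \<comment> \<open>A nonzero value means that no binomial vanishes, which bounds \<sigma> by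
        the labels, and that the two monomials agree, which the strict inequality forbids.\<close>
      then have "mono_weight (exponent L \<sigma>) < mono_weight (exponent L id)"
        by (intro mono_weight_exponent_less L)
          (auto simp: t_def lookup_single when_def not_less split: if_splits)
      then show False using nz by (auto simp: t_def lookup_single when_def split: if_splits)
    qed
  qed (auto simp: finite_permutations)
  also have "\<dots> \<noteq> 0"
  proof -
    have "snd (L ! c) choose c \<noteq> 0" if "c < length L" for c using L(2)[OF that] by simp
    then show ?thesis by (simp add: t_def)
  qed
  finally show ?thesis .
qed

section \<open>Homogeneous components\<close>

text \<open>A bihomogeneous component: \<open>d\<close> is the degree and \<open>w\<close> the total
  order of differentiation.\<close>

definition monomials :: "nat \<Rightarrow> nat \<Rightarrow> nat \<Rightarrow> (nat \<times> nat \<Rightarrow>\<^sub>0 nat) set" where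
  "monomials N d w = {m. Poly_Mapping.keys m \<subseteq> {1..N} \<times> UNIV \<and>
     size (factors m) = d \<and> (\<Sum>x\<in>#factors m. snd x) = w}"

text \<open>The total order bounds each single order, the indices lie in \<open>{1..N}\<close>, and
  the degree fixes the number of factors.\<close>

lemma finite_monomials: "finite (monomials N d w)"
proof (rule finite_imageD[of factors])
  have "factors ` monomials N d w \<subseteq> mset ` {xs. set xs \<subseteq> {1..N} \<times> {..w} \<and> length xs = d}"
  proof
    fix M assume "M \<in> factors ` monomials N d w"
    then obtain m where m: "M = factors m" "m \<in> monomials N d w" by blast
    obtain xs where xs: "mset xs = M" using ex_mset by blast
    have "snd x \<le> w" if "x \<in># M" for x
    proof -
      have "snd x \<le> sum_list (map snd xs)"
        using that by (intro member_le_sum_list) (auto simp flip: xs)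
      also have "\<dots> = w" using m by (auto simp: monomials_def simp flip: xs sum_mset_sum_list)
      finally show ?thesis .
    qed
    moreover have "fst x \<in> {1..N}" if "x \<in># M" for x
      using m that by (auto simp: monomials_def)
    ultimately have "set xs \<subseteq> {1..N} \<times> {..w}" by (force simp flip: xs)
    moreover have "length xs = d" using m xs by (auto simp: monomials_def simp flip: size_mset)
    ultimately show "M \<in> mset ` {xs. set xs \<subseteq> {1..N} \<times> {..w} \<and> length xs = d}" using xs by blast
  qed
  then show "finite (factors ` monomials N d w)"
    by (rule finite_subset) (intro finite_imageI finite_lists_length_eq, simp)
qed (simp add: inj_on_def factors_eq_iff)

text \<open>A permutation only rearranges the row numbers, so the total order is the same for every
  \<sigma>. The bound by the labels keeps the subtraction exact.\<close>

lemma exponent_in_monomials: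
  assumes "\<sigma> permutes {..<length L}" "\<And>c. c < length L \<Longrightarrow> \<sigma> c \<le> snd (L ! c)"
    and "fst ` set L \<subseteq> {1..N}"
  shows "exponent L \<sigma> \<in> monomials N (length L) ((\<Sum>c<length L. snd (L ! c)) - (\<Sum>c<length L. c))"
proof -
  have "(\<Sum>x\<in>#factors (exponent L \<sigma>). snd x) = (\<Sum>c<length L. snd (L ! c) - \<sigma> c)"
    by (simp add: factors_exponent image_mset.compositionality comp_def sum_unfold_sum_mset)
  also have "\<dots> = (\<Sum>c<length L. snd (L ! c)) - (\<Sum>c<length L. \<sigma> c)"
    using assms(2) by (intro sum_subtractf_nat) auto
  also have "(\<Sum>c<length L. \<sigma> c) = (\<Sum>c<length L. c)"
    using sum.permute[OF assms(1), of "\<lambda>c. c"] by (simp add: comp_def)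
  finally show ?thesis
    using assms(3) by (auto simp: monomials_def factors_exponent simp flip: set_mset_factors)
qed

text \<open>Naming the lead in the conclusion lets \<open>single_in_span\<close> match the component
  of the determinant with that of a given monomial.\<close>

lemma keys_det_subset_monomials:
  assumes "\<alpha> \<in> B_plus N"
  shows "\<exists>d w. lead N \<alpha> \<in> monomials N d w \<and> Poly_Mapping.keys (det (Delta0 N \<alpha>)) \<subseteq> monomials N d w"
proof -
  define L where "L = column_labels N \<alpha>"
  have L: "fst ` set L \<subseteq> {1..N}" "\<And>c. c < length L \<Longrightarrow> c \<le> snd (L ! c)"
    using labels_from_props(2)[OF assms, of 1] by (auto simp: L_def column_labels_eq simp del: upt_Suc)
  let ?w = "(\<Sum>c<length L. snd (L ! c)) - (\<Sum>c<length L. c)"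
  have "m \<in> monomials N (length L) ?w" if "m \<in> Poly_Mapping.keys (det (Delta0 N \<alpha>))" for m
  proof -
    from that obtain \<sigma> where "\<sigma> permutes {..<length L}"
      "\<And>c. c < length L \<Longrightarrow> \<sigma> c \<le> snd (L ! c)" "m = exponent L \<sigma>"
      unfolding L_def using keys_det by blast
    then show ?thesis using exponent_in_monomials[of \<sigma> L N] L(1) by simp
  qed
  moreover have "lead N \<alpha> \<in> Poly_Mapping.keys (det (Delta0 N \<alpha>))"
    using lookup_det_lead[OF assms] by (simp add: in_keys_iff)
  ultimately show ?thesis by (intro exI[of _ "length L"] exI[of _ ?w]) auto
qed

section \<open>Spanning by induction on the weight\<close>

text \<open>Real weights are not well ordered; on a finite set the number of points of smaller value
  serves as a measure.\<close>

lemma finite_less_induct [consumes 2, case_names less]: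
  fixes f :: "'a \<Rightarrow> 'b::linorder"
  assumes "finite S" "x \<in> S"
    and step: "\<And>x. x \<in> S \<Longrightarrow> (\<And>y. y \<in> S \<Longrightarrow> f y < f x \<Longrightarrow> P y) \<Longrightarrow> P x"
  shows "P x"
  using assms(2)
proof (induction "card {y \<in> S. f y < f x}" arbitrary: x rule: less_induct)
  case less
  show ?case
  proof (rule step[OF less.prems])
    fix y assume y: "y \<in> S" "f y < f x"
    have "card {z \<in> S. f z < f y} < card {z \<in> S. f z < f x}"
      using assms(1) y by (intro psubset_card_mono) auto
    then show "P y" using less.hyps y(1) by blast
  qed
qed

lemma diff_poly_eq_sum: "p = (\<Sum>m\<in>Poly_Mapping.keys p. dscale (Poly_Mapping.lookup p m) (Poly_Mapping.single m 1))"
  by (rule poly_mapping_eqI) (simp add: lookup_sum lookup_single when_def in_keys_iff if_distrib sum.delta cong: if_cong)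

text \<open>The determinant with lead \<open>m\<close> is in the span, and by induction so are its
  other monomials, which are lighter and in the same finite component. Subtracting them and dividing
  by the leading coefficient leaves \<open>m\<close>.\<close>

lemma single_in_span:
  assumes "Poly_Mapping.keys m \<subseteq> {1..N} \<times> UNIV"
  shows "Poly_Mapping.single m 1 \<in> dpoly.span ((\<lambda>\<alpha>. det (Delta0 N \<alpha>)) ` B_plus N)" (is "_ \<in> ?V")
proof -
  define d where "d = size (factors m)"
  define w where "w = (\<Sum>x\<in>#factors m. snd x)"
  have "m \<in> monomials N d w" using assms by (simp add: monomials_def d_def w_def)
  with finite_monomials show ?thesis
  proof (induction m rule: finite_less_induct[where f = mono_weight])
    case (less m)
    then obtain \<alpha> where \<alpha>: "\<alpha> \<in> B_plus N" "lead N \<alpha> = m"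
      using lead_surj[of m N] by (auto simp: monomials_def)
    define D where "D = det (Delta0 N \<alpha>)"
    obtain d' w' where dw: "m \<in> monomials N d' w'" "Poly_Mapping.keys D \<subseteq> monomials N d' w'"
      using keys_det_subset_monomials[OF \<alpha>(1)] unfolding D_def \<alpha>(2) by blast
    \<comment> \<open>\<open>m\<close> determines its degree and total order, so the two components
      coincide.\<close>
    then have "d' = d" "w' = w" using less(1) by (auto simp: monomials_def)
    with dw have mem: "Poly_Mapping.keys D \<subseteq> monomials N d w" by simp
    have nz: "Poly_Mapping.lookup D m \<noteq> 0" using lookup_det_lead[OF \<alpha>(1)] \<alpha>(2) by (simp add: D_def)
    define R where
      "R = (\<Sum>m'\<in>Poly_Mapping.keys D - {m}. dscale (Poly_Mapping.lookup D m') (Poly_Mapping.single m' 1))"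
    have "R \<in> ?V"
      unfolding R_def
    proof (intro dpoly.span_sum dpoly.span_scale)
      fix m' assume m': "m' \<in> Poly_Mapping.keys D - {m}"
      then have "mono_weight m' < mono_weight m"
        using mono_weight_keys_det[OF \<alpha>(1), of m'] unfolding \<alpha>(2) D_def by blast
      then show "Poly_Mapping.single m' 1 \<in> ?V"
        using m' mem by (intro less(2)) auto
    qed
    moreover have "D \<in> ?V" unfolding D_def using \<alpha>(1) by (intro dpoly.span_base) auto
    ultimately have "D - R \<in> ?V" by (intro dpoly.span_diff)
    moreover have "D - R = dscale (Poly_Mapping.lookup D m) (Poly_Mapping.single m 1)"
    proof -
      have "D = (\<Sum>m'\<in>Poly_Mapping.keys D. dscale (Poly_Mapping.lookup D m') (Poly_Mapping.single m' 1))"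
        by (rule diff_poly_eq_sum)
      also have "\<dots> = dscale (Poly_Mapping.lookup D m) (Poly_Mapping.single m 1) + R"
        unfolding R_def using nz by (intro sum.remove) (auto simp: in_keys_iff)
      finally show ?thesis by (simp only: diff_eq_eq)
    qed
    ultimately have "dscale (Poly_Mapping.lookup D m) (Poly_Mapping.single m 1) \<in> ?V" by (simp only:)
    then have "dscale (inverse (Poly_Mapping.lookup D m)) (dscale (Poly_Mapping.lookup D m) (Poly_Mapping.single m 1)) \<in> ?V"
      by (rule dpoly.span_scale)
    then show ?case using nz by simp
  qed
qed

lemma subspace_diff_poly_space: "dpoly.subspace (diff_poly_space N)"
  unfolding dpoly.subspace_def
proof (intro conjI ballI allI)
  fix p q assume "p \<in> diff_poly_space N" "q \<in> diff_poly_space N"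
  then show "p + q \<in> diff_poly_space N"
    using keys_add[of p q] by (fastforce simp: diff_poly_space_def)
next
  fix c p assume "p \<in> diff_poly_space N"
  then show "dscale c p \<in> diff_poly_space N"
    by (auto simp: diff_poly_space_def in_keys_iff)
qed (simp add: diff_poly_space_def)

theorem theorem1p4:
  fixes N :: nat
  assumes "1 \<le> N"
  shows "inj_on (\<lambda>\<alpha>. det (Delta0 N \<alpha>)) (B_plus N)
    \<and> dpoly.independent ((\<lambda>\<alpha>. det (Delta0 N \<alpha>)) ` B_plus N)
    \<and> dpoly.span ((\<lambda>\<alpha>. det (Delta0 N \<alpha>)) ` B_plus N) = diff_poly_space N"
proof (intro conjI)
  note triangular = triangular_family[of "lead N" "B_plus N" "\<lambda>\<alpha>. det (Delta0 N \<alpha>)" mono_weight,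
      OF inj_on_lead lookup_det_lead mono_weight_keys_det]
  show "inj_on (\<lambda>\<alpha>. det (Delta0 N \<alpha>)) (B_plus N)" by (rule triangular(1))
  show "dpoly.independent ((\<lambda>\<alpha>. det (Delta0 N \<alpha>)) ` B_plus N)" by (rule triangular(2))
  show "dpoly.span ((\<lambda>\<alpha>. det (Delta0 N \<alpha>)) ` B_plus N) = diff_poly_space N" (is "?V = _")
  proof
    \<comment> \<open>\<open>monomials\<close> also records that all indices lie in
      \<open>{1..N}\<close>.\<close>
    have "det (Delta0 N \<alpha>) \<in> diff_poly_space N" if \<alpha>: "\<alpha> \<in> B_plus N" for \<alpha>
    proof -
      obtain d w where "Poly_Mapping.keys (det (Delta0 N \<alpha>)) \<subseteq> monomials N d w"
        using keys_det_subset_monomials[OF \<alpha>] by blast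
      then show ?thesis by (auto simp: diff_poly_space_def monomials_def)
    qed
    then show "?V \<subseteq> diff_poly_space N"
      by (intro dpoly.span_minimal subspace_diff_poly_space) auto
    show "diff_poly_space N \<subseteq> ?V"
    proof
      fix p assume "p \<in> diff_poly_space N"
      then show "p \<in> ?V"
        unfolding diff_poly_space_def
        by (subst diff_poly_eq_sum[of p]) (intro dpoly.span_sum dpoly.span_scale single_in_span, blast)
    qed
  qed
qed

end
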